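(* Let $g=\sum_{k=1}^t c_km_k$ be a real polynomial in the bounded variables $x_1,\dots,x_n$, let $[\![g]\!]$ be its linearization in the reformulated variables $\mathbf w$, and define $$E^-(g)=\sum_{(k,\ell):\,c_ka_{k,\ell}<0}c_ka_{k,\ell}(n_{k,\ell}-1),\qquad E^+(g)=\sum_{(k,\ell):\,c_ka_{k,\ell}>0}c_ka_{k,\ell}(n_{k,\ell}-1),$$ where the sums run over $1\le k\le t$, $1\le\ell\le s_k$ (all notation as defined in the context). Then for every $\mathbf w\in\Phi_w$, $$E^-(g)\;\le\;[\![g]\!](\mathbf w)-g(\mathbf x(\mathbf w))\;\le\;E^+(g).$$
   Context: Variables and parameters. For $i=1,\dots,n$ the real variable $x_i$ has constant bounds $\alpha_i\le x_i\le\beta_i$ (of arbitrary sign). If $\alpha_i<\beta_i$, a constant $\kappa_i$ with $0<\kappa_i\le\beta_i-\alpha_i$ is given and $\sigma_i=\lceil\log_2((\beta_i-\alpha_i)/\kappa_i)\rceil\ge0$; if $\alpha_i=\beta_i$, then $\kappa_i=0$ and $\sigma_i=0$. Introduce binary unit variables $u_{i,j}\in\{0,1\}$ ($1\le j\le\sigma_i$) and a real remainder variable $r_i\in[0,1]$, and set $$x_i(\mathbf w)=\alpha_i+\kappa_i\sum_{j=1}^{\sigma_i}2^{j-1}u_{i,j}+\kappa_i r_i .$$ Monomials and elements. Let $m_1,\dots,m_t$ be the monomials occurring in the problem, $m_k=\prod_{i\in I_k}x_i$, where $I_k$ is a finite tuple of indices from $\{1,\dots,n\}$, possibly with repetitions,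 possibly empty (empty product $=1$). The polynomial $g$ is written $g=\sum_{k=1}^t c_k m_k$ with $c_k\in\mathbb R$. Substituting the expressions $x_i(\mathbf w)$ into $m_k$ and distributing the product over the sums (without combining terms or simplifying powers) gives $m_k=z_{k,1}+\dots+z_{k,s_k}$, where each element $z_{k,\ell}$ arises by choosing, for each position of $I_k$ with index $i$, one of the summands $\alpha_i$, $\kappa_i2^{j-1}u_{i,j}$ ($1\le j\le\sigma_i$), $\kappa_i r_i$, and multiplying the choices. For an element $z_{k,\ell}$, let $n_u$ be the number of chosen unit variables $u_{i_1,j_1},\dots,u_{i_{n_u},j_{n_u}}$ and $n_r$ the number of chosen remainder variables $r_{h_1},\dots,r_{h_{n_r}}$ (both counted with multiplicity), and let $n_{k,\ell}=\max(n_r,1)$. Let $a_{k,\ell}$ be $1/n_{k,\ell}$ times the product of all constant factors in the chosen summands (the chosen $\alpha_i$, the $\kappa_i2^{j-1}$ of the chosen unit summands, the $\kappa_i$ of the chosen remainder summands), so that $z_{k,\ell}=a_{k,\ell}n_{k,\ell}\,(u_{i_1,j_1}\cdots u_{i_{n_u},j_{n_u}})(r_{h_1}\cdots r_{h_{n_r}})$. Linearization. For each $(k,\ell)$ and each $h=1,\dots,n_{k,\ell}$ introduce a real unit-product variable $y_{k,\ell,h}\in[0,1]$. Let $\rho_h=r_{h_h}$ denote the $h$-th chosen remainder variable of $z_{k,\ell}$ if $n_r>0$, and $\rho_1=1$ if $n_r=0$. Impose the linear constraints $$y_{k,\ell,h}\le u_{i_p,j_p}\ (p=1,\dots,n_u),\qquad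 y_{k,\ell,h}\le\rho_h,\qquad y_{k,\ell,h}\ge\rho_h+u_{i_1,j_1}+\dots+u_{i_{n_u},j_{n_u}}-n_u .$$ Let $\mathbf w$ be the tuple of all unit, remainder and unit-product variables. $\Phi_w$ is the set of all $\mathbf w$ with $u_{i,j}\in\{0,1\}$, $r_i\in[0,1]$, $y_{k,\ell,h}\in[0,1]$ satisfying all these constraints for all $(k,\ell,h)$ together with $x_i(\mathbf w)\le\beta_i$ for all $i$. Write $\mathbf x(\mathbf w)=(x_1(\mathbf w),\dots,x_n(\mathbf w))$. The linearization of $g$ is the linear function $$[\![g]\!](\mathbf w)=\sum_{k=1}^t\sum_{\ell=1}^{s_k}\sum_{h=1}^{n_{k,\ell}}c_ka_{k,\ell}\,y_{k,\ell,h}.$$ *)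

theory Defs
  imports Complex_Main
begin

text \<open>
  All indices (of variables, bits, monomials, elements and unit-product variables) start at 1.
  The coefficients of a polynomial are kept apart from the problem data, since the reformulation
  depends only on the monomials and the bounds. A monomial is the list of its variable indices,
  with repetitions.
\<close>

record problem =
  nvars :: nat
  lower :: "nat \<Rightarrow> real"
  upper :: "nat \<Rightarrow> real"
  unit_size :: "nat \<Rightarrow> real"
  nmons :: nat
  mon   :: "nat \<Rightarrow> nat list"

definition valid_problem :: "problem \<Rightarrow> bool" where
  "valid_problem P \<longleftrightarrow>
     (\<forall>i\<in>{1..nvars P}.
        lower P i \<le> upper P i \<and>
        (lower P i < upper P i \<longrightarrow> 0 < unit_size P i \<and> unit_size P i \<le> upper P i - lower P i) \<and>
        (lower P i = upper P i \<longrightarrow> unit_size P i = 0)) \<and>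
     (\<forall>k\<in>{1..nmons P}. set (mon P k) \<subseteq> {1..nvars P})"

definition nbits :: "problem \<Rightarrow> nat \<Rightarrow> nat" where
  "nbits P i =
     (if lower P i < upper P i
      then nat \<lceil>log 2 ((upper P i - lower P i) / unit_size P i)\<rceil> else 0)"

record point =
  unit_var :: "nat \<Rightarrow> nat \<Rightarrow> real"
  rem_var  :: "nat \<Rightarrow> real"
  prod_var :: "nat \<Rightarrow> nat \<Rightarrow> nat \<Rightarrow> real"

definition x_of :: "problem \<Rightarrow> point \<Rightarrow> nat \<Rightarrow> real" where
  "x_of P w i =
     lower P i + unit_size P i * (\<Sum>j=1..nbits P i. 2 ^ (j - 1) * unit_var w i j)
       + unit_size P i * rem_var w i"

definition mon_eval :: "problem \<Rightarrow> nat \<Rightarrow> (nat \<Rightarrow> real) \<Rightarrow> real" where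
  "mon_eval P k x = (\<Prod>i\<leftarrow>mon P k. x i)"

definition poly_eval :: "problem \<Rightarrow> (nat \<Rightarrow> real) \<Rightarrow> (nat \<Rightarrow> real) \<Rightarrow> real" where
  "poly_eval P c x = (\<Sum>k=1..nmons P. c k * mon_eval P k x)"

text \<open>
  Symbols for the summands of \<open>x_of P w i\<close>, so that elements arising from different
  choices stay distinct even when their values agree.
\<close>

datatype summand = Const nat | Unit nat nat | Rem nat

definition summands :: "problem \<Rightarrow> nat \<Rightarrow> summand list" where
  "summands P i = Const i # map (Unit i) [1..<Suc (nbits P i)] @ [Rem i]"

definition elements :: "problem \<Rightarrow> nat \<Rightarrow> summand list list" where
  "elements P k = product_lists (map (summands P) (mon P k))"

definition nelems :: "problem \<Rightarrow> nat \<Rightarrow> nat" where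
  "nelems P k = length (elements P k)"

definition element :: "problem \<Rightarrow> nat \<Rightarrow> nat \<Rightarrow> summand list" where
  "element P k l = elements P k ! (l - 1)"

definition chosen_units :: "summand list \<Rightarrow> (nat \<times> nat) list" where
  "chosen_units e = [(i, j). Unit i j \<leftarrow> e]"

definition chosen_rems :: "summand list \<Rightarrow> nat list" where
  "chosen_rems e = [i. Rem i \<leftarrow> e]"

primrec const_factor :: "problem \<Rightarrow> summand \<Rightarrow> real" where
  "const_factor P (Const i) = lower P i"
| "const_factor P (Unit i j) = unit_size P i * 2 ^ (j - 1)"
| "const_factor P (Rem i) = unit_size P i"

definition elem_mult :: "problem \<Rightarrow> nat \<Rightarrow> nat \<Rightarrow> nat" where
  "elem_mult P k l = max (length (chosen_rems (element P k l))) 1"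

definition coef :: "problem \<Rightarrow> nat \<Rightarrow> nat \<Rightarrow> real" where
  "coef P k l = 1 / real (elem_mult P k l) * (\<Prod>s\<leftarrow>element P k l. const_factor P s)"

primrec summand_value :: "problem \<Rightarrow> point \<Rightarrow> summand \<Rightarrow> real" where
  "summand_value P w (Const i) = lower P i"
| "summand_value P w (Unit i j) = unit_size P i * 2 ^ (j - 1) * unit_var w i j"
| "summand_value P w (Rem i) = unit_size P i * rem_var w i"

definition element_value :: "problem \<Rightarrow> point \<Rightarrow> nat \<Rightarrow> nat \<Rightarrow> real" where
  "element_value P w k l = (\<Prod>s\<leftarrow>element P k l. summand_value P w s)"

lemma x_of_eq_sum_summands:
  "x_of P w i = (\<Sum>s\<leftarrow>summands P i. summand_value P w s)"
proof -
  have "(\<Sum>s\<leftarrow>map (Unit i) [1..<Suc n]. summand_value P w s) =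
      unit_size P i * (\<Sum>j=1..n. 2 ^ (j - 1) * unit_var w i j)" for n
    by (induction n) (simp_all add: distrib_left mult.assoc)
  then show ?thesis
    unfolding x_of_def summands_def by (simp del: upt_Suc)
qed

lemma prod_list_sum_list_distrib:
  fixes f :: "'a \<Rightarrow> real"
  shows "(\<Prod>xs\<leftarrow>xss. \<Sum>x\<leftarrow>xs. f x) = (\<Sum>ys\<leftarrow>product_lists xss. \<Prod>y\<leftarrow>ys. f y)"
proof (induction xss)
  case (Cons xs xss)
  have "(\<Sum>ys\<leftarrow>concat (map (\<lambda>x. map (Cons x) yss) xs). \<Prod>y\<leftarrow>ys. f y) =
      (\<Sum>x\<leftarrow>xs. f x) * (\<Sum>ys\<leftarrow>yss. \<Prod>y\<leftarrow>ys. f y)" for yss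
    by (induction xs) (simp_all add: o_def sum_list_const_mult distrib_right)
  then show ?case using Cons by simp
qed simp

lemma mon_eval_eq_sum_elements:
  "mon_eval P k (x_of P w) = (\<Sum>l=1..nelems P k. element_value P w k l)"
proof -
  have "mon_eval P k (x_of P w) = (\<Sum>e\<leftarrow>elements P k. \<Prod>s\<leftarrow>e. summand_value P w s)"
    using prod_list_sum_list_distrib[of "summand_value P w" "map (summands P) (mon P k)"]
    by (simp add: mon_eval_def elements_def x_of_eq_sum_summands[abs_def] o_def)
  also have "\<dots> = (\<Sum>l<nelems P k. element_value P w k (Suc l))"
    by (simp add: sum_list_sum_nth nelems_def element_value_def element_def atLeast0LessThan)
  also have "\<dots> = (\<Sum>l=1..nelems P k. element_value P w k l)"
    by (rule sum.reindex_bij_witness[of _ "\<lambda>l. l - 1" Suc]) auto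
  finally show ?thesis .
qed

lemma element_value_eq:
  "element_value P w k l =
     coef P k l * real (elem_mult P k l) *
       (\<Prod>(i, j)\<leftarrow>chosen_units (element P k l). unit_var w i j) *
       (\<Prod>i\<leftarrow>chosen_rems (element P k l). rem_var w i)"
proof -
  have "(\<Prod>s\<leftarrow>e. summand_value P w s) =
      (\<Prod>s\<leftarrow>e. const_factor P s) * (\<Prod>(i, j)\<leftarrow>chosen_units e. unit_var w i j) *
        (\<Prod>i\<leftarrow>chosen_rems e. rem_var w i)" for e
  proof (induction e)
    case (Cons s e)
    then show ?case by (cases s) (simp_all add: chosen_units_def chosen_rems_def)
  qed (simp add: chosen_units_def chosen_rems_def)
  moreover have "real (elem_mult P k l) \<noteq> 0" by (simp add: elem_mult_def)
  ultimately show ?thesis by (simp add: element_value_def coef_def)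
qed

definition rho :: "problem \<Rightarrow> point \<Rightarrow> nat \<Rightarrow> nat \<Rightarrow> nat \<Rightarrow> real" where
  "rho P w k l h =
     (let rs = chosen_rems (element P k l)
      in if length rs > 0 then rem_var w (rs ! (h - 1)) else 1)"

definition product_constraints :: "problem \<Rightarrow> point \<Rightarrow> nat \<Rightarrow> nat \<Rightarrow> nat \<Rightarrow> bool" where
  "product_constraints P w k l h \<longleftrightarrow>
     (let us = chosen_units (element P k l); y = prod_var w k l h
      in (\<forall>(i, j)\<in>set us. y \<le> unit_var w i j) \<and>
         y \<le> rho P w k l h \<and>
         y \<ge> rho P w k l h + (\<Sum>(i, j)\<leftarrow>us. unit_var w i j) - real (length us))"

definition Phi :: "problem \<Rightarrow> point set" where
  "Phi P = {w.
     (\<forall>i\<in>{1..nvars P}. \<forall>j\<in>{1..nbits P i}. unit_var w i j \<in> {0, 1}) \<and>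
     (\<forall>i\<in>{1..nvars P}. rem_var w i \<in> {0..1}) \<and>
     (\<forall>k\<in>{1..nmons P}. \<forall>l\<in>{1..nelems P k}. \<forall>h\<in>{1..elem_mult P k l}.
        prod_var w k l h \<in> {0..1} \<and> product_constraints P w k l h) \<and>
     (\<forall>i\<in>{1..nvars P}. x_of P w i \<le> upper P i)}"

definition linearization :: "problem \<Rightarrow> (nat \<Rightarrow> real) \<Rightarrow> point \<Rightarrow> real" where
  "linearization P c w =
     (\<Sum>k=1..nmons P. \<Sum>l=1..nelems P k. \<Sum>h=1..elem_mult P k l.
        c k * coef P k l * prod_var w k l h)"

definition element_indices :: "problem \<Rightarrow> (nat \<times> nat) set" where
  "element_indices P = (SIGMA k:{1..nmons P}. {1..nelems P k})"

definition E_minus :: "problem \<Rightarrow> (nat \<Rightarrow> real) \<Rightarrow> real" where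
  "E_minus P c =
     (\<Sum>(k, l)\<in>{(k, l)\<in>element_indices P. c k * coef P k l < 0}.
        c k * coef P k l * (real (elem_mult P k l) - 1))"

definition E_plus :: "problem \<Rightarrow> (nat \<Rightarrow> real) \<Rightarrow> real" where
  "E_plus P c =
     (\<Sum>(k, l)\<in>{(k, l)\<in>element_indices P. c k * coef P k l > 0}.
        c k * coef P k l * (real (elem_mult P k l) - 1))"

end

theory Submission imports Defs "HOL-Analysis.Infinite_Products" begin

text \<open>
  The constraints on a unit-product variable are exact at binary points: each \<open>y\<^sub>h\<close> equals
  \<open>U * \<rho>\<^sub>h\<close>, where \<open>U \<in> {0, 1}\<close> is the product of the chosen unit variables. So the error of one
  element is its coefficient times \<open>U * ((\<Sum>h. \<rho>\<^sub>h) - n * (\<Prod>h. \<rho>\<^sub>h))\<close>, and for \<open>\<rho>\<^sub>h \<in> [0, 1]\<close> this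
  factor lies between \<open>0\<close>, since the product is below every \<open>\<rho>\<^sub>h\<close>, and \<open>n - 1\<close>, by the Weierstrass
  inequality \<open>1 - (\<Prod>h. \<rho>\<^sub>h) \<le> (\<Sum>h. 1 - \<rho>\<^sub>h)\<close>. The sign of the coefficient decides which of the two
  bounds is the upper one.
\<close>

lemma sum_minus_card_mult_prod_bounds:
  fixes f :: "'a \<Rightarrow> real"
  assumes "finite A" "A \<noteq> {}" and f: "\<And>x. x \<in> A \<Longrightarrow> 0 \<le> f x \<and> f x \<le> 1"
  shows "0 \<le> sum f A - real (card A) * prod f A"
    and "sum f A - real (card A) * prod f A \<le> real (card A) - 1"
proof -
  have "prod f A \<le> f x" if "x \<in> A" for x
  proof -
    have "prod f (A - {x}) \<le> 1"
      using f by (intro prod_le_1) auto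
    moreover have "prod f A = f x * prod f (A - {x})"
      using assms(1) that by (rule prod.remove)
    ultimately show ?thesis
      using f[OF that] by (simp add: mult_left_le)
  qed
  then show "0 \<le> sum f A - real (card A) * prod f A"
    using sum_bounded_below[of A "prod f A" f] by simp
  have "1 - (\<Sum>x\<in>A. 1 - f x) \<le> (\<Prod>x\<in>A. 1 - (1 - f x))"
    using f by (intro Weierstrass_prod_ineq) auto
  then have "sum f A \<le> real (card A) - 1 + prod f A"
    by (simp add: sum_subtractf)
  \<comment> \<open>With \<open>n = card A\<close>, the Weierstrass bound leaves
    \<open>n - 1 - (n - 1) * prod f A\<close>; the last term may be dropped because \<open>A\<close>
    is nonempty, so \<open>n\<close> is at least 1.\<close>
  moreover have "0 \<le> (real (card A) - 1) * prod f A"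
    using assms f by (intro mult_nonneg_nonneg prod_nonneg) (auto simp: Suc_le_eq card_gt_0_iff)
  ultimately show "sum f A - real (card A) * prod f A \<le> real (card A) - 1"
    by (simp add: algebra_simps)
qed

text \<open>Multiplying by a negative \<open>a\<close> reverses the bounds on \<open>d\<close>, so
  on each side the extreme comes from \<open>m\<close> for one sign of \<open>a\<close> and from 0
  for the other.\<close>

lemma mult_interval_bounds:
  fixes a d m :: real
  assumes "0 \<le> d" "d \<le> m"
  shows "(if a < 0 then a * m else 0) \<le> a * d"
    and "a * d \<le> (if a > 0 then a * m else 0)"
  using assms by (auto simp: mult_left_mono mult_left_mono_neg zero_le_mult_iff mult_le_0_iff)

lemma set_chosen_units: "set (chosen_units e) = {(i, j). Unit i j \<in> set e}"
  by (auto simp: chosen_units_def split: summand.splits)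

lemma set_chosen_rems: "set (chosen_rems e) = {i. Rem i \<in> set e}"
  by (auto simp: chosen_rems_def split: summand.splits)

text \<open>An entry 0 squeezes \<open>y\<close> to 0. Otherwise all entries are 1, their sum
  cancels the length, and \<open>y\<close> is pinned to \<open>r\<close> from both sides.\<close>

lemma prod_list_binary_eq:
  fixes xs :: "real list"
  assumes "set xs \<subseteq> {0, 1}" "0 \<le> y" "\<And>x. x \<in> set xs \<Longrightarrow> y \<le> x"
    "y \<le> r" "r + sum_list xs - real (length xs) \<le> y"
  shows "y = prod_list xs * r"
proof (cases "0 \<in> set xs")
  case True
  then have "prod_list xs = 0"
    by (simp add: prod_list_zero_iff)
  with True assms(2,3) show ?thesis by fastforce
next
  case False
  then have "xs = replicate (length xs) 1"
    using assms(1) by (intro replicate_eqI) auto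
  then have "prod_list xs = 1" "sum_list xs = real (length xs)"
    using prod_list_replicate[of "length xs" "1 :: real"]
      sum_list_replicate[of "length xs" "1 :: real"]
    by simp_all
  then show ?thesis
    using assms(4,5) by simp
qed

lemma elem_mult_pos: "0 < elem_mult P k l"
  by (simp add: elem_mult_def)

text \<open>An element without remainder variables still has one factor, \<open>rho = 1\<close>,
  which agrees with the empty product; hence both kinds of element can be treated alike.\<close>

lemma prod_rho_eq:
  "(\<Prod>h=1..elem_mult P k l. rho P w k l h) = (\<Prod>i\<leftarrow>chosen_rems (element P k l). rem_var w i)"
proof (cases "chosen_rems (element P k l) = []")
  case False
  define rs where "rs = chosen_rems (element P k l)"
  have "(\<Prod>h=1..length rs. rem_var w (rs ! (h - 1))) = (\<Prod>h<length rs. rem_var w (rs ! h))"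
    by (rule prod.reindex_bij_witness[of _ Suc "\<lambda>h. h - 1"]) auto
  also have "\<dots> = (\<Prod>i\<leftarrow>rs. rem_var w i)"
    by (simp add: prod.list_conv_set_nth atLeast0LessThan)
  finally have "(\<Prod>h=1..length rs. rem_var w (rs ! (h - 1))) = (\<Prod>i\<leftarrow>rs. rem_var w i)" .
  moreover have "elem_mult P k l = length rs"
    using False by (cases rs) (auto simp: elem_mult_def rs_def)
  ultimately show ?thesis
    using False by (simp add: rho_def rs_def)
qed (simp add: rho_def elem_mult_def)

text \<open>\<open>Phi\<close> restricts only variables with indices in range, so its constraints
  apply to an element only once its chosen variables are known to be in range.\<close>

lemma element_summands:
  assumes "valid_problem P" "k \<in> {1..nmons P}" "l \<in> {1..nelems P k}" "s \<in> set (element P k l)"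
  shows "\<exists>i\<in>{1..nvars P}. s \<in> set (summands P i)"
proof -
  have "element P k l \<in> set (product_lists (map (summands P) (mon P k)))"
    using assms(3) nth_mem[of "l - 1" "elements P k"]
    by (auto simp: element_def elements_def nelems_def)
  then have "list_all2 (\<lambda>s xs. s \<in> set xs) (element P k l) (map (summands P) (mon P k))"
    by (simp add: product_lists_set)
  then have "\<exists>i\<in>set (mon P k). s \<in> set (summands P i)"
    using assms(4) by (fastforce simp: list_all2_conv_all_nth in_set_conv_nth[of s "element P k l"])
  moreover have "set (mon P k) \<subseteq> {1..nvars P}"
    using assms(1,2) by (simp add: valid_problem_def)
  ultimately show ?thesis by blast
qed

lemma chosen_units_range:
  assumes "valid_problem P" "k \<in> {1..nmons P}" "l \<in> {1..nelems P k}"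
    and "(i, j) \<in> set (chosen_units (element P k l))"
  shows "i \<in> {1..nvars P}" "j \<in> {1..nbits P i}"
  using element_summands[OF assms(1-3), of "Unit i j"] assms(4)
  by (auto simp: set_chosen_units summands_def simp del: upt_Suc)

lemma chosen_rems_range:
  assumes "valid_problem P" "k \<in> {1..nmons P}" "l \<in> {1..nelems P k}"
    and "i \<in> set (chosen_rems (element P k l))"
  shows "i \<in> {1..nvars P}"
  using element_summands[OF assms(1-3), of "Rem i"] assms(4)
  by (auto simp: set_chosen_rems summands_def simp del: upt_Suc)

text \<open>The linearized element minus the exact one, with the coefficient divided out so that its
  sign can be handled separately.\<close>

definition element_error :: "problem \<Rightarrow> point \<Rightarrow> nat \<Rightarrow> nat \<Rightarrow> real" where
  "element_error P w k l =
     (\<Sum>h=1..elem_mult P k l. prod_var w k l h) -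
     real (elem_mult P k l) * (\<Prod>(i, j)\<leftarrow>chosen_units (element P k l). unit_var w i j) *
       (\<Prod>i\<leftarrow>chosen_rems (element P k l). rem_var w i)"

context
  fixes P w k l
  assumes valid: "valid_problem P" and w: "w \<in> Phi P"
    and k: "k \<in> {1..nmons P}" and l: "l \<in> {1..nelems P k}"
begin

lemma unit_var_binary:
  "(i, j) \<in> set (chosen_units (element P k l)) \<Longrightarrow> unit_var w i j \<in> {0, 1}"
  using chosen_units_range[OF valid k l] w by (auto simp: Phi_def)

lemma rho_bounds:
  assumes "h \<in> {1..elem_mult P k l}"
  shows "0 \<le> rho P w k l h \<and> rho P w k l h \<le> 1"
proof (cases "chosen_rems (element P k l) = []")
  case False
  then have "h - 1 < length (chosen_rems (element P k l))"
    using assms by (cases h) (auto simp: elem_mult_def max_def Suc_le_eq split: if_splits)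
  then have "chosen_rems (element P k l) ! (h - 1) \<in> {1..nvars P}"
    using chosen_rems_range[OF valid k l] nth_mem by blast
  then show ?thesis
    using False w by (auto simp: rho_def Phi_def)
qed (simp add: rho_def)

lemma prod_var_eq:
  assumes "h \<in> {1..elem_mult P k l}"
  shows "prod_var w k l h =
    (\<Prod>(i, j)\<leftarrow>chosen_units (element P k l). unit_var w i j) * rho P w k l h"
proof (rule prod_list_binary_eq)
  have "prod_var w k l h \<in> {0..1}" and "product_constraints P w k l h"
    using w k l assms by (auto simp: Phi_def)
  then show "0 \<le> prod_var w k l h" "prod_var w k l h \<le> rho P w k l h"
    "rho P w k l h + (\<Sum>(i, j)\<leftarrow>chosen_units (element P k l). unit_var w i j)
       - real (length (map (\<lambda>(i, j). unit_var w i j) (chosen_units (element P k l))))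
     \<le> prod_var w k l h"
    "\<And>x. x \<in> set (map (\<lambda>(i, j). unit_var w i j) (chosen_units (element P k l)))
       \<Longrightarrow> prod_var w k l h \<le> x"
    by (auto simp: product_constraints_def Let_def)
  show "set (map (\<lambda>(i, j). unit_var w i j) (chosen_units (element P k l))) \<subseteq> {0, 1}"
    using unit_var_binary by auto
qed

lemma element_error_bounds:
  shows "0 \<le> element_error P w k l"
    and "element_error P w k l \<le> real (elem_mult P k l) - 1"
proof -
  define U where "U = (\<Prod>(i, j)\<leftarrow>chosen_units (element P k l). unit_var w i j)"
  let ?H = "{1..elem_mult P k l}"
  have "(\<Sum>h\<in>?H. prod_var w k l h) = (\<Sum>h\<in>?H. U * rho P w k l h)"
    unfolding U_def using prod_var_eq by (intro sum.cong refl)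
  then have "element_error P w k l =
      (\<Sum>h\<in>?H. U * rho P w k l h) - real (card ?H) * U * (\<Prod>h\<in>?H. rho P w k l h)"
    unfolding element_error_def prod_rho_eq U_def by simp
  also have "\<dots> = U * ((\<Sum>h\<in>?H. rho P w k l h) - real (card ?H) * (\<Prod>h\<in>?H. rho P w k l h))"
    by (simp add: sum_distrib_left algebra_simps)
  finally have d: "element_error P w k l = \<dots>" .
  have "?H \<noteq> {}"
    using elem_mult_pos[of P k l] by simp
  note bounds = sum_minus_card_mult_prod_bounds[OF _ this rho_bounds]
  \<comment> \<open>Generalized to lists \<open>us\<close> of chosen units, since the tail in the
    induction is no longer the unit list of the element.\<close>
  have "(\<Prod>(i, j)\<leftarrow>us. unit_var w i j) \<in> {0, 1}"
    if "set us \<subseteq> set (chosen_units (element P k l))" for us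
    using that by (induction us) (use unit_var_binary in fastforce)+
  then have "U \<in> {0, 1}"
    by (simp add: U_def)
  \<comment> \<open>For \<open>U = 0\<close> the error vanishes and \<open>elem_mult_pos\<close>
    gives the upper bound; for \<open>U = 1\<close> both claims are \<open>bounds\<close>.\<close>
  then show "0 \<le> element_error P w k l" "element_error P w k l \<le> real (elem_mult P k l) - 1"
    using d bounds elem_mult_pos[of P k l] by auto
qed

end

theorem proposition4:
  fixes P :: problem and c :: "nat \<Rightarrow> real" and w :: point
  assumes "valid_problem P"
    and "w \<in> Phi P"
  shows "E_minus P c \<le> linearization P c w - poly_eval P c (x_of P w) \<and>
    linearization P c w - poly_eval P c (x_of P w) \<le> E_plus P c"
proof -
  define a where "a = (\<lambda>(k, l). c k * coef P k l)"
  define m where "m = (\<lambda>(k, l). real (elem_mult P k l) - 1)"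
  define d where "d = (\<lambda>(k, l). element_error P w k l)"
  let ?S = "element_indices P"
  have fin: "finite ?S"
    by (simp add: element_indices_def)
  have diff: "linearization P c w - poly_eval P c (x_of P w) = (\<Sum>p\<in>?S. a p * d p)"
  proof -
    have "(\<Sum>p\<in>?S. a p * d p) = (\<Sum>k=1..nmons P. \<Sum>l=1..nelems P k. a (k, l) * d (k, l))"
      by (simp add: element_indices_def sum.Sigma split_def)
    \<comment> \<open>The factor \<open>elem_mult P k l\<close> in \<open>element_error\<close>
      undoes the division in \<open>coef\<close>, so the subtracted term is exactly the element's
      value.\<close>
    also have "\<dots> = (\<Sum>k=1..nmons P. \<Sum>l=1..nelems P k.
        (\<Sum>h=1..elem_mult P k l. c k * coef P k l * prod_var w k l h) - c k * element_value P w k l)"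
      by (simp add: a_def d_def element_error_def element_value_eq sum_distrib_left
          right_diff_distrib mult.assoc)
    also have "\<dots> = linearization P c w - poly_eval P c (x_of P w)"
      by (simp add: linearization_def poly_eval_def mon_eval_eq_sum_elements sum_subtractf
          sum_distrib_left)
    finally show ?thesis ..
  qed
  have d: "0 \<le> d p" "d p \<le> m p" if "p \<in> ?S" for p
    using that element_error_bounds[OF assms] by (auto simp: element_indices_def d_def m_def)
  have "E_minus P c = (\<Sum>p\<in>{p\<in>?S. a p < 0}. a p * m p)"
    by (auto simp: E_minus_def a_def m_def split_def intro!: sum.cong)
  \<comment> \<open>Padding with zeros makes both sums range over all elements, so they can be
    compared termwise.\<close>
  also have "\<dots> = (\<Sum>p\<in>?S. if a p < 0 then a p * m p else 0)"
    using fin by (rule sum.inter_filter)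
  also have "\<dots> \<le> (\<Sum>p\<in>?S. a p * d p)"
    using d by (intro sum_mono mult_interval_bounds(1))
  finally have lower: "E_minus P c \<le> (\<Sum>p\<in>?S. a p * d p)" .
  have "(\<Sum>p\<in>?S. a p * d p) \<le> (\<Sum>p\<in>?S. if a p > 0 then a p * m p else 0)"
    using d by (intro sum_mono mult_interval_bounds(2))
  also have "\<dots> = (\<Sum>p\<in>{p\<in>?S. a p > 0}. a p * m p)"
    using fin by (rule sum.inter_filter[symmetric])
  also have "\<dots> = E_plus P c"
    by (auto simp: E_plus_def a_def m_def split_def intro!: sum.cong)
  finally show ?thesis
    using lower diff by simp
qed

end
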